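(* Let $G$ and $H$ be finite connected multigraphs with $G$ transitive and $G\succcurlyeq H$. Then $$\tau(G)^{1/|G|}\ge \tau(H)^{1/|H|},$$ and the inequality is strict when $G$ contains no cut-edge and $G\ne H$.
   Context: $\tau(K)$ is the number of spanning trees of a finite connected multigraph $K$; $|K|$ is its number of vertices. A graph is transitive if its automorphism group acts transitively on vertices. $G\succcurlyeq H$ ($G$ dominates $H$) means there is a probability measure on pairs $(X,Y)\in V(G)\times V(H)$ whose two marginals are uniform on $V(G)$ and on $V(H)$ respectively, such that almost surely there is an isomorphism from $H$ onto a subgraph of $G$ carrying $Y$ to $X$. A cut-edge is an edge whose removal disconnects the graph. *)

theory Defs
  imports "HOL-Probability.Probability_Mass_Function"
begin

record ('v, 'e) mgraph =
  verts :: "'v set"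
  edges :: "'e set"
  ends  :: "'e \<Rightarrow> 'v set"

definition wf_mgraph :: "('v, 'e) mgraph \<Rightarrow> bool" where
  "wf_mgraph G \<longleftrightarrow> finite (verts G) \<and> finite (edges G) \<and>
     (\<forall>e\<in>edges G. ends G e \<subseteq> verts G \<and> card (ends G e) = 2)"

inductive reach :: "('v, 'e) mgraph \<Rightarrow> 'e set \<Rightarrow> 'v \<Rightarrow> 'v \<Rightarrow> bool"
  for G F where
  refl: "x \<in> verts G \<Longrightarrow> reach G F x x"
| step: "reach G F x y \<Longrightarrow> e \<in> F \<Longrightarrow> e \<in> edges G \<Longrightarrow> ends G e = {y, z}
          \<Longrightarrow> reach G F x z"

definition connected_on :: "('v, 'e) mgraph \<Rightarrow> 'e set \<Rightarrow> bool" where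
  "connected_on G F \<longleftrightarrow> verts G \<noteq> {} \<and> (\<forall>x\<in>verts G. \<forall>y\<in>verts G. reach G F x y)"

definition mg_connected :: "('v, 'e) mgraph \<Rightarrow> bool" where
  "mg_connected G \<longleftrightarrow> connected_on G (edges G)"

definition cut_edge :: "('v, 'e) mgraph \<Rightarrow> 'e \<Rightarrow> bool" where
  "cut_edge G e \<longleftrightarrow> e \<in> edges G \<and> \<not> connected_on G (edges G - {e})"

definition spanning_tree :: "('v, 'e) mgraph \<Rightarrow> 'e set \<Rightarrow> bool" where
  "spanning_tree G T \<longleftrightarrow> T \<subseteq> edges G \<and> connected_on G T \<and>
     (\<forall>e\<in>T. \<not> connected_on G (T - {e}))"

definition tau :: "('v, 'e) mgraph \<Rightarrow> nat" where
  "tau G = card {T. spanning_tree G T}"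

definition mg_embedding :: "('v, 'e) mgraph \<Rightarrow> ('w, 'f) mgraph \<Rightarrow> ('w \<Rightarrow> 'v) \<Rightarrow> ('f \<Rightarrow> 'e) \<Rightarrow> bool" where
  "mg_embedding G H f g \<longleftrightarrow>
     inj_on f (verts H) \<and> f ` verts H \<subseteq> verts G \<and>
     inj_on g (edges H) \<and> g ` edges H \<subseteq> edges G \<and>
     (\<forall>e\<in>edges H. ends G (g e) = f ` ends H e)"

definition mg_iso :: "('v, 'e) mgraph \<Rightarrow> ('w, 'f) mgraph \<Rightarrow> ('w \<Rightarrow> 'v) \<Rightarrow> ('f \<Rightarrow> 'e) \<Rightarrow> bool" where
  "mg_iso G H f g \<longleftrightarrow>
     bij_betw f (verts H) (verts G) \<and> bij_betw g (edges H) (edges G) \<and>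
     (\<forall>e\<in>edges H. ends G (g e) = f ` ends H e)"

definition mg_isomorphic :: "('v, 'e) mgraph \<Rightarrow> ('w, 'f) mgraph \<Rightarrow> bool" where
  "mg_isomorphic G H \<longleftrightarrow> (\<exists>f g. mg_iso G H f g)"

definition vertex_transitive :: "('v, 'e) mgraph \<Rightarrow> bool" where
  "vertex_transitive G \<longleftrightarrow>
     (\<forall>x\<in>verts G. \<forall>y\<in>verts G. \<exists>f g. mg_iso G G f g \<and> f x = y)"

definition dominates :: "('v, 'e) mgraph \<Rightarrow> ('w, 'f) mgraph \<Rightarrow> bool" where
  "dominates G H \<longleftrightarrow>
     (\<exists>p :: ('v \<times> 'w) pmf.
        map_pmf fst p = pmf_of_set (verts G) \<and>
        map_pmf snd p = pmf_of_set (verts H) \<and>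
        (\<forall>(x, y)\<in>set_pmf p. \<exists>f g. mg_embedding G H f g \<and> f y = x))"

end

theory Submission
  imports Defs
begin

text \<open>By transitivity, domination amounts to a single embedding of \<open>H\<close> into \<open>G\<close>. Order the
  vertices of \<open>G\<close> so that each one but the first is adjacent to an earlier one, and give \<open>x\<close> the
  weight \<open>ln C(x)\<close>, with \<open>C(x)\<close> the effective conductance in \<open>G\<close> between \<open>x\<close> and its
  predecessors. All weights are nonnegative, and they telescope to \<open>ln \<tau>(G)\<close>. On any copy of
  \<open>H\<close> in \<open>G\<close>, Rayleigh monotonicity bounds the weights from below by those that the restricted
  ordering produces in \<open>H\<close>, whose sum is \<open>ln \<tau>(H)\<close> whatever the ordering. Averaging over the
  images of one copy under the automorphisms of \<open>G\<close> gives
  \<open>ln \<tau>(H) \<le> |H| / |G| * ln \<tau>(G)\<close>.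

  For strictness, if the copy misses a vertex, start the ordering there: the first vertex of the
  copy has positive weight in \<open>G\<close> when there is no cut-edge, and weight \<open>0\<close> in \<open>H\<close>. Otherwise
  some edge is missing, and starting the ordering at one endpoint makes the weight of the other
  strictly larger in \<open>G\<close>.\<close>

section \<open>Rooted forests as parent functions\<close>

text \<open>A spanning forest with root set \<open>A\<close> is encoded by sending each vertex outside \<open>A\<close> to the
  first edge of its path to a root. The number \<open>n\<close> in \<open>flows G A p n v b\<close> is the length of that
  path; since it is determined by \<open>v\<close>, it rules out cycles.\<close>

inductive flows :: "('v, 'e) mgraph \<Rightarrow> 'v set \<Rightarrow> ('v \<Rightarrow> 'e) \<Rightarrow> nat \<Rightarrow> 'v \<Rightarrow> 'v \<Rightarrow> bool"
  for G A p where
  root: "b \<in> A \<Longrightarrow> flows G A p 0 b b"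
| up: "v \<notin> A \<Longrightarrow> ends G (p v) = {v, w} \<Longrightarrow> flows G A p n w b \<Longrightarrow> flows G A p (Suc n) v b"

definition rforests :: "('v, 'e) mgraph \<Rightarrow> 'v set \<Rightarrow> ('v \<Rightarrow> 'e) set" where
  "rforests G A = {p \<in> (verts G - A) \<rightarrow>\<^sub>E edges G. \<forall>v\<in>verts G. \<exists>n b. flows G A p n v b}"

text \<open>The edge is kept beside the neighbour, so that parallel edges count separately in the
  Laplacian.\<close>

definition star :: "('v, 'e) mgraph \<Rightarrow> 'v \<Rightarrow> ('e \<times> 'v) set" where
  "star G u = {(e, v). e \<in> edges G \<and> ends G e = {u, v}}"

text \<open>Divided by the number of forests rooted at \<open>insert x A\<close>, this is the voltage at \<open>z\<close> when
  \<open>x\<close> is held at 1 and \<open>A\<close> at 0.\<close>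

definition hits :: "('v, 'e) mgraph \<Rightarrow> 'v set \<Rightarrow> 'v \<Rightarrow> 'v \<Rightarrow> nat" where
  "hits G A x z = card {p \<in> rforests G (insert x A). \<exists>n. flows G (insert x A) p n z x}"

definition lap :: "('v, 'e) mgraph \<Rightarrow> ('v \<Rightarrow> real) \<Rightarrow> 'v \<Rightarrow> real" where
  "lap G f u = (\<Sum>(e, v)\<in>star G u. f u - f v)"

section \<open>Paths along parent edges, and their behaviour when one parent changes\<close>

lemma rforestsD: "p \<in> rforests G A \<Longrightarrow> v \<in> verts G \<Longrightarrow> \<exists>n b. flows G A p n v b"
  by (simp add: rforests_def)

lemma flows_root: "flows G A p n v b \<Longrightarrow> b \<in> A"
  by (induction rule: flows.induct) auto

text \<open>An edge at \<open>v\<close> has only one other end, so a path outside the root set has a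
  single continuation.\<close>

lemma flows_det: "flows G A p n v b \<Longrightarrow> flows G A p m v c \<Longrightarrow> n = m \<and> b = c"
proof (induction arbitrary: m c rule: flows.induct)
  case (root b)
  from root(2) root(1) show ?case by cases simp_all
next
  case (up v w n b)
  from up.prems up(1) obtain w' m' where w': "m = Suc m'" "ends G (p v) = {v, w'}"
    "flows G A p m' w' c" by cases simp_all
  then have "w' = w" using up(2) by (auto simp: doubleton_eq_iff)
  then have "n = m' \<and> b = c" using up.IH w'(3) by blast
  then show ?case using w'(1) by simp
qed

lemma flows_shorter: "flows G A p n v b \<Longrightarrow> m < n \<Longrightarrow> \<not> flows G A p m v c"
  using flows_det[of G A p n v b m c] by auto

lemma flows_unique: "flows G A p n v b \<Longrightarrow> flows G A p m v c \<Longrightarrow> b = c"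
  using flows_det[of G A p n v b m c] by auto

lemma flows_up_upd:
  assumes "v \<notin> A" "v \<noteq> z" "ends G (p v) = {v, w}" "flows G A (p(z := e)) n w b"
  shows "flows G A (p(z := e)) (Suc n) v b"
  using assms by (intro flows.up) auto

text \<open>The path of \<open>w\<close> never meets \<open>z\<close>, since otherwise
  \<open>z\<close> would reach \<open>b\<close> in at most \<open>n\<close> steps. The bound
  \<open>n\<close> lets this serve both when \<open>z\<close> has another root and when
  \<open>z\<close> is further from \<open>b\<close>.\<close>

lemma flows_upd:
  assumes "flows G A p n w b" and "\<And>m. m \<le> n \<Longrightarrow> \<not> flows G A p m z b"
  shows "flows G A (p(z := e)) n w b"
  using assms
proof (induction rule: flows.induct)
  case (root b)
  then show ?case by (blast intro: flows.root)
next
  case (up v w n b)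
  have "v \<noteq> z"
  proof
    assume "v = z"
    moreover have "flows G A p (Suc n) v b" by (rule flows.up) (fact up)+
    ultimately show False using up.prems[of "Suc n"] by simp
  qed
  moreover have "flows G A (p(z := e)) n w b" by (rule up.IH) (simp add: up.prems)
  ultimately show ?case using flows_up_upd[where p = p and z = z and v = v and w = w] up(1,2)
    by (simp del: fun_upd_apply)
qed

text \<open>Follow the old path until it first meets \<open>z\<close>, then continue along the new
  path of \<open>z\<close>.\<close>

lemma flows_upd_ex:
  assumes "flows G A p n v b" and "flows G A (p(z := e)) k z c"
  shows "\<exists>n b. flows G A (p(z := e)) n v b"
  using assms(1)
proof (induction rule: flows.induct)
  case (root b)
  then show ?case by (blast intro: flows.root)
next
  case (up v w n b)
  from up.IH obtain m d where "flows G A (p(z := e)) m w d" by (elim exE)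
  then have "v \<noteq> z \<Longrightarrow> flows G A (p(z := e)) (Suc m) v d"
    using flows_up_upd[where p = p and z = z and v = v and w = w] up(1,2)
    by (simp del: fun_upd_apply)
  then show ?case using assms(2) by (cases "v = z") (simp del: fun_upd_apply, iprover, iprover)
qed

text \<open>\<open>z\<close> is hung on a vertex of another tree, so no cycle can arise. The old
  parent \<open>w0\<close> keeps its root \<open>b\<close>, because its path is shorter than that of
  \<open>z\<close> and so avoids \<open>z\<close>; this makes the exchange reversible.\<close>

lemma rforests_swap:
  assumes p: "p \<in> rforests G A" and z: "z \<in> verts G" "z \<notin> A"
    and e: "e \<in> edges G" "ends G e = {z, w}"
    and zb: "flows G A p n z b" and wc: "flows G A p m w c" and bc: "b \<noteq> c"
  shows "p(z := e) \<in> rforests G A"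
    and "\<exists>k. flows G A (p(z := e)) k z c"
    and "\<exists>w0 k. p z \<in> edges G \<and> ends G (p z) = {z, w0} \<and> flows G A (p(z := e)) k w0 b"
proof -
  have "\<not> flows G A p k z c" for k
    using flows_unique[OF zb] bc by blast
  with wc have "flows G A (p(z := e)) m w c"
    by (rule flows_upd)
  then have zc: "flows G A (p(z := e)) (Suc m) z c"
    using flows.up[where p = "p(z := e)" and v = z] z e by simp
  then show "\<exists>k. flows G A (p(z := e)) k z c" by blast
  have "\<exists>n b. flows G A (p(z := e)) n v b" if "v \<in> verts G" for v
  proof -
    obtain k d where "flows G A p k v d" using rforestsD[OF p \<open>v \<in> verts G\<close>] by blast
    then show ?thesis using zc by (rule flows_upd_ex)
  qed
  moreover have "p(z := e) \<in> (verts G - A) \<rightarrow>\<^sub>E edges G"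
    using p z e by (auto simp: rforests_def PiE_iff extensional_def)
  ultimately show "p(z := e) \<in> rforests G A"
    by (auto simp: rforests_def)
  from zb z obtain w0 n0 where w0: "n = Suc n0" "ends G (p z) = {z, w0}" "flows G A p n0 w0 b"
    by cases auto
  have "flows G A (p(z := e)) n0 w0 b"
    using w0 zb by (intro flows_upd) (use flows_shorter[OF zb] in auto)
  then show "\<exists>w0 k. p z \<in> edges G \<and> ends G (p z) = {z, w0} \<and> flows G A (p(z := e)) k w0 b"
    using w0 p z by (auto simp: rforests_def)
qed

section \<open>The Laplacian of the counts \<open>hits\<close>\<close>

lemma finite_star: "wf_mgraph G \<Longrightarrow> finite (star G u)"
  by (rule finite_subset[of _ "edges G \<times> verts G"]) (auto simp: star_def wf_mgraph_def)

lemma star_verts: "wf_mgraph G \<Longrightarrow> (e, v) \<in> star G u \<Longrightarrow> u \<in> verts G \<and> v \<in> verts G \<and> u \<noteq> v"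
  unfolding star_def wf_mgraph_def by (cases "u = v") auto

lemma finite_rforests: "wf_mgraph G \<Longrightarrow> finite (rforests G A)"
  by (rule finite_subset[of _ "(verts G - A) \<rightarrow>\<^sub>E edges G"])
    (auto simp: rforests_def wf_mgraph_def intro!: finite_PiE)

text \<open>A count of forests is a sum of indicators, so the Laplacian is a signed count of pairs
  of a forest and an edge at \<open>z\<close> exactly one of whose ends has root
  \<open>x\<close>.\<close>

lemma lap_hits_eq:
  fixes x :: 'v and A :: "'v set" and G :: "('v, 'e) mgraph"
  assumes wf: "wf_mgraph G"
  defines "P \<equiv> rforests G (insert x A)" and "h \<equiv> \<lambda>p v. \<exists>n. flows G (insert x A) p n v x"
  shows "lap G (\<lambda>v. real (hits G A x v)) z =
    real (card {(p, e, w). p \<in> P \<and> (e, w) \<in> star G z \<and> h p z \<and> \<not> h p w}) -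
    real (card {(p, e, w). p \<in> P \<and> (e, w) \<in> star G z \<and> \<not> h p z \<and> h p w})"
proof -
  note fin = finite_rforests[OF wf, of "insert x A", folded P_def] finite_star[OF wf, of z]
  have N: "real (hits G A x v) = (\<Sum>p\<in>P. of_bool (h p v))" for v
    using fin by (simp add: hits_def P_def h_def sum.If_cases of_bool_def Int_def)
  have "lap G (\<lambda>v. real (hits G A x v)) z =
      (\<Sum>d\<in>star G z. \<Sum>p\<in>P. of_bool (h p z) - of_bool (h p (snd d)))"
    by (simp add: lap_def N case_prod_beta sum_subtractf)
  also have "\<dots> = (\<Sum>(p, d)\<in>P \<times> star G z. of_bool (h p z) - of_bool (h p (snd d)))"
    by (subst sum.swap) (simp add: sum.cartesian_product)
  also have "\<dots> = (\<Sum>q\<in>P \<times> star G z. of_bool (h (fst q) z \<and> \<not> h (fst q) (snd (snd q)))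
       - of_bool (\<not> h (fst q) z \<and> h (fst q) (snd (snd q))))"
    by (intro sum.cong) auto
  also have "\<dots> = real (card {q\<in>P \<times> star G z. h (fst q) z \<and> \<not> h (fst q) (snd (snd q))}) -
      real (card {q\<in>P \<times> star G z. \<not> h (fst q) z \<and> h (fst q) (snd (snd q))})"
    using fin by (simp add: sum_subtractf of_bool_def sum.If_cases Int_def)
  also have "{q\<in>P \<times> star G z. h (fst q) z \<and> \<not> h (fst q) (snd (snd q))} =
      {(p, e, w). p \<in> P \<and> (e, w) \<in> star G z \<and> h p z \<and> \<not> h p w}" by auto
  also have "{q\<in>P \<times> star G z. \<not> h (fst q) z \<and> h (fst q) (snd (snd q))} =
      {(p, e, w). p \<in> P \<and> (e, w) \<in> star G z \<and> \<not> h p z \<and> h p w}" by auto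
  finally show ?thesis .
qed

text \<open>Exchanging the parent edge of \<open>z\<close> with another edge at \<open>z\<close> is an involution that swaps
  the pairs counted positively with those counted negatively in \<open>lap_hits_eq\<close>.\<close>

lemma hits_harmonic:
  assumes wf: "wf_mgraph G" and z: "z \<in> verts G" "z \<notin> insert x A"
  shows "lap G (\<lambda>v. real (hits G A x v)) z = 0"
proof -
  define P where "P = rforests G (insert x A)"
  define h where "h = (\<lambda>p v. \<exists>n. flows G (insert x A) p n v x)"
  define S1 where "S1 = {(p, e, w). p \<in> P \<and> (e, w) \<in> star G z \<and> h p z \<and> \<not> h p w}"
  define S2 where "S2 = {(p, e, w). p \<in> P \<and> (e, w) \<in> star G z \<and> \<not> h p z \<and> h p w}"
  define oth where "oth e = (THE w. ends G e = {z, w})" for e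
  \<comment> \<open>The displaced parent edge and its other end are recorded, so that a second
    application of \<open>\<phi>\<close> restores the triple.\<close>
  define \<phi> where "\<phi> = (\<lambda>(p, e, w :: 'a). (p(z := e), p z, oth (p z)))"
  have oth: "oth e = w" if "ends G e = {z, w}" for e w
    unfolding oth_def using that by (intro the_equality) (auto simp: doubleton_eq_iff)
  have total: "\<exists>n b. flows G (insert x A) p n v b" if "p \<in> P" "v \<in> verts G" for p v
    using that unfolding P_def by (rule rforestsD)
  have inv: "\<phi> (\<phi> q) = q" if "q \<in> S1 \<union> S2" for q
    using that by (auto simp: \<phi>_def S1_def S2_def star_def oth)
  \<comment> \<open>Here \<open>z\<close> leaves the tree of \<open>x\<close> while its former
    parent stays in it; \<open>21\<close> is the reverse exchange.\<close>
  have 12: "\<phi> q \<in> S2" if "q \<in> S1" for q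
  proof -
    obtain p e w where q: "q = (p, e, w)" by (cases q)
    with that have *: "p \<in> P" "(e, w) \<in> star G z" "h p z" "\<not> h p w" by (auto simp: S1_def)
    obtain n where n: "flows G (insert x A) p n z x" using * unfolding h_def by blast
    obtain m c where m: "flows G (insert x A) p m w c"
      using total[OF *(1), of w] star_verts[OF wf *(2)] by blast
    have c: "c \<noteq> x" using m *(3,4) unfolding h_def by blast
    have ez: "e \<in> edges G" "ends G e = {z, w}" using *(2) by (auto simp: star_def)
    note sw = rforests_swap[OF *(1)[unfolded P_def] z ez n m c[symmetric]]
    then obtain w0 k where w0: "p z \<in> edges G" "ends G (p z) = {z, w0}"
      "flows G (insert x A) (p(z := e)) k w0 x" by blast
    from sw(2) obtain k' where "flows G (insert x A) (p(z := e)) k' z c" by blast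
    then have "\<not> h (p(z := e)) z"
      using flows_unique c unfolding h_def by metis
    moreover have "h (p(z := e)) w0" using w0 unfolding h_def by blast
    ultimately show ?thesis using w0 sw(1)
      by (simp add: q \<phi>_def S2_def star_def P_def oth)
  qed
  have 21: "\<phi> q \<in> S1" if "q \<in> S2" for q
  proof -
    obtain p e w where q: "q = (p, e, w)" by (cases q)
    with that have *: "p \<in> P" "(e, w) \<in> star G z" "\<not> h p z" "h p w" by (auto simp: S2_def)
    obtain n where n: "flows G (insert x A) p n w x" using * unfolding h_def by blast
    obtain m c where m: "flows G (insert x A) p m z c"
      using total[OF *(1) z(1)] by blast
    have c: "c \<noteq> x" using m *(3,4) unfolding h_def by blast
    have ez: "e \<in> edges G" "ends G e = {z, w}" using *(2) by (auto simp: star_def)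
    note sw = rforests_swap[OF *(1)[unfolded P_def] z ez m n c]
    then obtain w0 k where w0: "p z \<in> edges G" "ends G (p z) = {z, w0}"
      "flows G (insert x A) (p(z := e)) k w0 c" by blast
    have "\<not> h (p(z := e)) w0"
      using flows_unique[OF w0(3)] c unfolding h_def by metis
    moreover have "h (p(z := e)) z" using sw(2) unfolding h_def by blast
    ultimately show ?thesis using w0 sw(1)
      by (simp add: q \<phi>_def S1_def star_def P_def oth)
  qed
  have "bij_betw \<phi> S1 S2"
    by (rule bij_betw_byWitness[of _ \<phi>]) (use inv 12 21 in auto)
  then have "card S1 = card S2" by (rule bij_betw_same_card)
  moreover have "lap G (\<lambda>v. real (hits G A x v)) z = real (card S1) - real (card S2)"
    unfolding S1_def S2_def P_def h_def by (rule lap_hits_eq[OF wf])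
  ultimately show ?thesis by simp
qed

lemma hits_root: "hits G A x x = card (rforests G (insert x A))"
  unfolding hits_def by (rule arg_cong[of _ _ card]) (blast intro: flows.root)

lemma hits_other:
  assumes "v \<in> A" and "v \<noteq> x"
  shows "hits G A x v = 0"
proof -
  have "\<not> flows G (insert x A) p n v x" for p n
    using flows_unique[OF flows.root[of v "insert x A" G p]] assms by blast
  then show ?thesis by (simp add: hits_def)
qed

text \<open>The old path is kept until it meets \<open>x\<close>, where it now ends; as
  \<open>x\<close> is a root, any value \<open>e\<close> may stand there.\<close>

lemma flows_insert:
  assumes "flows G A p n v b"
  shows "\<exists>m c. flows G (insert x A) (p(x := e)) m v c"
  using assms
proof (induction rule: flows.induct)
  case (root b)
  then show ?case by (blast intro: flows.root)
next
  case (up v w n b)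
  from up.IH obtain m c where "flows G (insert x A) (p(x := e)) m w c" by (elim exE)
  then have "v \<noteq> x \<Longrightarrow> flows G (insert x A) (p(x := e)) (Suc m) v c"
    using flows_up_upd[where p = p and z = x and v = v and w = w] up(1,2)
    by (simp del: fun_upd_apply)
  moreover have "v = x \<Longrightarrow> flows G (insert x A) (p(x := e)) 0 v v"
    by (simp add: flows.root del: fun_upd_apply)
  ultimately show ?case by (cases "v = x") iprover+
qed

lemma flows_insert_avoid:
  assumes "flows G A p n v b" and "\<And>m. m \<le> n \<Longrightarrow> \<not> flows G A p m x b"
  shows "flows G (insert x A) (p(x := e)) n v b"
  using assms
proof (induction rule: flows.induct)
  case (root b)
  then show ?case by (blast intro: flows.root)
next
  case (up v w n b)
  have "v \<noteq> x"
  proof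
    assume "v = x"
    moreover have "flows G A p (Suc n) v b" by (rule flows.up) (fact up)+
    ultimately show False using up.prems[of "Suc n"] by simp
  qed
  moreover have "flows G (insert x A) (p(x := e)) n w b" by (rule up.IH) (simp add: up.prems)
  ultimately show ?case using flows_up_upd[where p = p and z = x and v = v and w = w] up(1,2)
    by (simp del: fun_upd_apply)
qed

text \<open>A path stops at the first root it meets, so one that ends elsewhere never visits
  \<open>x\<close> and survives when \<open>x\<close> ceases to be a root.\<close>

lemma flows_delete:
  assumes "flows G (insert x A) p n v b" and "b \<noteq> x"
  shows "flows G A (p(x := e)) n v b"
  using assms
proof (induction rule: flows.induct)
  case (root b)
  then show ?case by (blast intro: flows.root)
next
  case (up v w n b)
  then show ?case
    using flows_up_upd[where p = p and z = x and v = v and w = w] up(1,2)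
    by (simp del: fun_upd_apply)
qed

lemma flows_delete_ex:
  assumes "flows G (insert x A) p n v b" and "flows G A (p(x := e)) k x c"
  shows "\<exists>n b. flows G A (p(x := e)) n v b"
  using assms
proof (induction rule: flows.induct)
  case (root b)
  then show ?case by (blast intro: flows.root)
next
  case (up v w n b)
  from up.IH[OF up.prems] obtain m c where "flows G A (p(x := e)) m w c" by (elim exE)
  then have "flows G A (p(x := e)) (Suc m) v c"
    using flows_up_upd[where p = p and z = x and v = v and w = w] up(1,2)
    by (simp del: fun_upd_apply)
  then show ?case by blast
qed

text \<open>Deleting the parent edge of \<open>x\<close> makes \<open>x\<close> a root and leaves an
  edge from \<open>x\<close> to another tree; such an edge can be put back. Since \<open>x\<close>
  always has root \<open>x\<close>, only these pairs remain in \<open>lap_hits_eq\<close>.\<close>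

lemma lap_hits_root:
  assumes wf: "wf_mgraph G" and x: "x \<in> verts G" "x \<notin> A"
  shows "lap G (\<lambda>v. real (hits G A x v)) x = real (card (rforests G A))"
proof -
  define P where "P = rforests G (insert x A)"
  define h where "h = (\<lambda>p v. \<exists>n. flows G (insert x A) p n v x)"
  define S where "S = {(p, e, w). p \<in> P \<and> (e, w) \<in> star G x \<and> h p x \<and> \<not> h p w}"
  define oth where "oth e = (THE w. ends G e = {x, w})" for e
  have oth: "oth e = w" if "ends G e = {x, w}" for e w
    unfolding oth_def using that by (intro the_equality) (auto simp: doubleton_eq_iff)
  have hx: "h p x" for p by (auto simp: h_def intro: flows.root)
  \<comment> \<open>Forests are extensional functions, so the value at the new root must be reset to
    \<open>undefined\<close>.\<close>
  define i where "i = (\<lambda>q :: 'a \<Rightarrow> 'b. (q(x := undefined), q x, oth (q x)))"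
  define j where "j = (\<lambda>(p :: 'a \<Rightarrow> 'b, e :: 'b, w :: 'a). p(x := e))"
  have iS: "i q \<in> S" and ji: "j (i q) = q" if q: "q \<in> rforests G A" for q
  proof -
    obtain n b where nb: "flows G A q n x b" using rforestsD[OF q x(1)] by blast
    from nb x obtain w n0 where w: "n = Suc n0" "ends G (q x) = {x, w}" "flows G A q n0 w b"
      by cases auto
    have w': "flows G (insert x A) (q(x := undefined)) n0 w b"
      using w nb by (intro flows_insert_avoid) (use flows_shorter[OF nb] in auto)
    moreover have "b \<noteq> x" using flows_root[OF nb] x by auto
    ultimately have "\<not> h (q(x := undefined)) w" unfolding h_def using flows_unique[OF w'] by blast
    moreover have "\<exists>n b. flows G (insert x A) (q(x := undefined)) n v b" if v: "v \<in> verts G" for v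
    proof -
      obtain k d where "flows G A q k v d" using rforestsD[OF q v] by blast
      then show ?thesis by (rule flows_insert)
    qed
    then have "q(x := undefined) \<in> P"
      using q by (simp add: P_def rforests_def PiE_iff extensional_def)
    moreover have "q x \<in> edges G" using q x by (auto simp: rforests_def)
    ultimately show "i q \<in> S" using w hx by (auto simp: i_def S_def star_def oth)
    show "j (i q) = q" by (simp add: i_def j_def)
  qed
  have jS: "j s \<in> rforests G A" and ij: "i (j s) = s" if s: "s \<in> S" for s
  proof -
    obtain p e w where s': "s = (p, e, w)" by (cases s)
    with s have *: "p \<in> P" "(e, w) \<in> star G x" "\<not> h p w" by (auto simp: S_def)
    obtain m c where m: "flows G (insert x A) p m w c"
      using rforestsD[OF *(1)[unfolded P_def], of w] star_verts[OF wf *(2)] by blast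
    then have "c \<noteq> x" using *(3) unfolding h_def by blast
    then have "flows G A (p(x := e)) m w c" using m by (intro flows_delete)
    then have xc: "flows G A (p(x := e)) (Suc m) x c"
      using flows.up[where p = "p(x := e)" and v = x] * x by (simp add: star_def)
    have "\<exists>n b. flows G A (p(x := e)) n v b" if v: "v \<in> verts G" for v
    proof -
      obtain k d where "flows G (insert x A) p k v d"
        using rforestsD[OF *(1)[unfolded P_def] v] by blast
      then show ?thesis using xc by (rule flows_delete_ex)
    qed
    moreover have "p(x := e) \<in> (verts G - A) \<rightarrow>\<^sub>E edges G"
      using * x by (auto simp: P_def rforests_def PiE_iff extensional_def star_def)
    ultimately show "j s \<in> rforests G A" by (simp add: s' j_def rforests_def)
    have "p x = undefined" using * by (auto simp: P_def rforests_def PiE_iff extensional_def)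
    then show "i (j s) = s" using * by (auto simp: s' i_def j_def star_def oth)
  qed
  have "bij_betw i (rforests G A) S"
    by (rule bij_betw_byWitness[of _ j]) (use iS ji jS ij in auto)
  then have "card (rforests G A) = card S" by (rule bij_betw_same_card)
  moreover have "{(p, e, w). p \<in> P \<and> (e, w) \<in> star G x \<and> \<not> h p x \<and> h p w} = {}"
    using hx by auto
  moreover have "lap G (\<lambda>v. real (hits G A x v)) x = real (card S) -
      real (card {(p, e, w). p \<in> P \<and> (e, w) \<in> star G x \<and> \<not> h p x \<and> h p w})"
    unfolding S_def P_def h_def by (rule lap_hits_eq[OF wf])
  ultimately show ?thesis by (simp only: card.empty of_nat_0 diff_0_right)
qed

section \<open>Effective conductance and Dirichlet energy\<close>

definition darts :: "('v, 'e) mgraph \<Rightarrow> ('e \<times> 'v \<times> 'v) set" where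
  "darts G = {(e, u, v). e \<in> edges G \<and> ends G e = {u, v}}"

text \<open>Every edge contributes two darts, so this is twice the usual Dirichlet form.\<close>

definition dform :: "('v, 'e) mgraph \<Rightarrow> ('v \<Rightarrow> real) \<Rightarrow> ('v \<Rightarrow> real) \<Rightarrow> real" where
  "dform G f g = (\<Sum>(e, u, v)\<in>darts G. (f u - f v) * (g u - g v))"

text \<open>Effective conductance between \<open>x\<close> and \<open>A\<close> with unit
  conductances, in its matrix-tree form. As a ratio of forest counts it telescopes along an
  ordering.\<close>

definition cond :: "('v, 'e) mgraph \<Rightarrow> 'v set \<Rightarrow> 'v \<Rightarrow> real" where
  "cond G A x = real (card (rforests G A)) / real (card (rforests G (insert x A)))"

definition pot :: "('v, 'e) mgraph \<Rightarrow> 'v set \<Rightarrow> 'v \<Rightarrow> 'v \<Rightarrow> real" where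
  "pot G A x v = real (hits G A x v) / real (card (rforests G (insert x A)))"

lemma finite_darts: "wf_mgraph G \<Longrightarrow> finite (darts G)"
  by (rule finite_subset[of _ "edges G \<times> verts G \<times> verts G"]) (auto simp: darts_def wf_mgraph_def)

text \<open>Summation by parts: grouping darts by their start gives the Laplacian, and reversing
  them shows that the terms with \<open>g v\<close> contribute the same amount again.\<close>

lemma dform_lap:
  assumes wf: "wf_mgraph G"
  shows "dform G f g = 2 * (\<Sum>u\<in>verts G. g u * lap G f u)"
proof -
  define T where "T = (\<Sum>(e, u, v)\<in>darts G. (f u - f v) * g u)"
  have fin: "finite (verts G)" using wf by (simp add: wf_mgraph_def)
  have "(\<Sum>u\<in>verts G. g u * lap G f u) = (\<Sum>u\<in>verts G. \<Sum>d\<in>star G u. g u * (f u - f (snd d)))"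
    by (simp add: lap_def sum_distrib_left case_prod_beta)
  also have "\<dots> = (\<Sum>(u, d)\<in>Sigma (verts G) (star G). g u * (f u - f (snd d)))"
    using fin finite_star[OF wf] by (simp add: sum.Sigma)
  also have "\<dots> = T"
    unfolding T_def
    by (rule sum.reindex_bij_witness[of _ "\<lambda>(e, u, v). (u, e, v)" "\<lambda>(u, e, v). (e, u, v)"])
      (use star_verts[OF wf] in \<open>auto simp: darts_def star_def\<close>)
  finally have T: "(\<Sum>u\<in>verts G. g u * lap G f u) = T" .
  have "(\<Sum>(e, u, v)\<in>darts G. (f u - f v) * g v) = (\<Sum>(e, u, v)\<in>darts G. - ((f u - f v) * g u))"
    by (rule sum.reindex_bij_witness[of _ "\<lambda>(e, u, v). (e, v, u)" "\<lambda>(e, u, v). (e, v, u)"])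
      (auto simp: darts_def insert_commute algebra_simps)
  also have "\<dots> = - T" by (simp add: T_def sum_negf case_prod_beta)
  finally have "(\<Sum>(e, u, v)\<in>darts G. (f u - f v) * g v) = - T" .
  then have "dform G f g = T - (- T)"
    unfolding dform_def T_def
    by (simp add: case_prod_beta right_diff_distrib sum_subtractf)
  with T show ?thesis by simp
qed

lemma dform_nonneg: "0 \<le> dform G f f"
  unfolding dform_def by (intro sum_nonneg) auto

lemma dform_square_add:
  "dform G (\<lambda>v. f v + g v) (\<lambda>v. f v + g v) = dform G f f + 2 * dform G f g + dform G g g"
  unfolding dform_def sum_distrib_left sum.distrib[symmetric]
  by (intro sum.cong) (auto simp: algebra_simps)

lemma reach_verts: "wf_mgraph G \<Longrightarrow> reach G F x y \<Longrightarrow> y \<in> verts G"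
  by (erule reach.induct) (auto simp: wf_mgraph_def)

lemma boundary_edge:
  assumes wf: "wf_mgraph G" and "connected_on G F" and "a \<in> A" "a \<in> verts G"
    and "x \<in> verts G" "x \<notin> A"
  shows "\<exists>e\<in>F. \<exists>u\<in>verts G - A. \<exists>v\<in>A. e \<in> edges G \<and> ends G e = {u, v}"
proof -
  have "reach G F a x" using assms by (auto simp: connected_on_def)
  then show ?thesis using assms(3-6)
  proof (induction rule: reach.induct)
    case (refl y)
    then show ?case by simp
  next
    case (step a y e z)
    show ?case
    proof (cases "y \<in> A")
      case True
      have "ends G e = {z, y}" using step(4) by auto
      then show ?thesis using True step by blast
    next
      case False
      then show ?thesis using step reach_verts[OF wf step(1)] by blast
    qed
  qed
qed

lemma hits_le: "wf_mgraph G \<Longrightarrow> hits G A x v \<le> card (rforests G (insert x A))"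
  unfolding hits_def by (intro card_mono finite_rforests) auto

text \<open>In the Laplacian at \<open>x\<close>, whose value counts the forests rooted at
  \<open>A\<close>, all terms are nonnegative, and the edge \<open>e\<close> alone contributes the
  number of forests rooted at \<open>insert x A\<close>.\<close>

lemma rforests_mono_root:
  assumes wf: "wf_mgraph G" and e: "e \<in> edges G" "ends G e = {x, a}" and x: "x \<in> verts G - A" "a \<in> A"
  shows "card (rforests G (insert x A)) \<le> card (rforests G A)"
proof -
  have *: "(e, a) \<in> star G x" using e by (simp add: star_def)
  have "real (card (rforests G (insert x A))) = real (hits G A x x) - real (hits G A x a)"
    using x by (subst hits_other) (auto simp: hits_root)
  also have "\<dots> = (case (e, a) of (e, w) \<Rightarrow> real (hits G A x x) - real (hits G A x w))" by simp
  also have "\<dots> \<le> lap G (\<lambda>v. real (hits G A x v)) x"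
    unfolding lap_def
    by (rule member_le_sum) (use * finite_star[OF wf] hits_le[OF wf] in \<open>auto simp: hits_root\<close>)
  also have "\<dots> = real (card (rforests G A))"
    using x by (intro lap_hits_root[OF wf]) auto
  finally show ?thesis by simp
qed

lemma rforests_verts: "rforests G (verts G) = {\<lambda>_. undefined}"
proof -
  have "\<exists>n b. flows G (verts G) p n v b" if "v \<in> verts G" for p v
    using flows.root[OF that] by blast
  then show ?thesis by (auto simp: rforests_def)
qed

text \<open>Induction down from the full root set, which has exactly one forest; a boundary edge
  supplies a vertex \<open>u\<close> to which \<open>rforests_mono_root\<close> applies.\<close>

lemma rforests_pos:
  assumes wf: "wf_mgraph G" and con: "mg_connected G" and A: "A \<subseteq> verts G" "A \<noteq> {}"
  shows "0 < card (rforests G A)"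
proof -
  have fin: "finite (verts G)" using wf by (simp add: wf_mgraph_def)
  from A show ?thesis
  proof (induction "card (verts G - A)" arbitrary: A rule: less_induct)
    case less
    show ?case
    proof (cases "A = verts G")
      case True
      then show ?thesis by (simp add: rforests_verts)
    next
      case False
      with less.prems obtain a x where "a \<in> A" "x \<in> verts G" "x \<notin> A" by blast
      with boundary_edge[OF wf con[unfolded mg_connected_def]] less.prems
      obtain e u v where e: "e \<in> edges G" "u \<in> verts G - A" "v \<in> A" "ends G e = {u, v}"
        by (metis subsetD)
      have "card (verts G - insert u A) < card (verts G - A)"
        using fin e by (intro psubset_card_mono) auto
      then have "0 < card (rforests G (insert u A))"
        using e less.prems by (intro less.hyps) auto
      also have "\<dots> \<le> card (rforests G A)" by (rule rforests_mono_root[OF wf e(1,4,2,3)])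
      finally show ?thesis .
    qed
  qed
qed

lemma lap_divide: "lap G (\<lambda>v. f v / c) u = lap G f u / c"
  by (simp add: lap_def sum_divide_distrib case_prod_beta diff_divide_distrib)

lemma pot_other: "v \<in> A \<Longrightarrow> v \<noteq> x \<Longrightarrow> pot G A x v = 0"
  by (simp add: pot_def hits_other)

lemma pot_root:
  assumes "wf_mgraph G" "mg_connected G" "A \<subseteq> verts G" "x \<in> verts G"
  shows "pot G A x x = 1"
  using rforests_pos[OF assms(1,2), of "insert x A"] assms by (auto simp: pot_def hits_root)

text \<open>In \<open>dform_lap\<close> only the term of \<open>x\<close> survives: \<open>g\<close>
  vanishes on \<open>A\<close>, the voltage is harmonic off \<open>insert x A\<close>, and its
  Laplacian at \<open>x\<close> is the conductance.\<close>

lemma dform_pot: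
  assumes wf: "wf_mgraph G" and A: "A \<subseteq> verts G" and x: "x \<in> verts G" "x \<notin> A"
    and g: "\<And>a. a \<in> A \<Longrightarrow> g a = 0"
  shows "dform G (pot G A x) g = 2 * (g x * cond G A x)"
proof -
  have fin: "finite (verts G)" using wf by (simp add: wf_mgraph_def)
  have lap: "lap G (pot G A x) u =
      lap G (\<lambda>v. real (hits G A x v)) u / real (card (rforests G (insert x A)))" for u
    unfolding lap_divide[symmetric] by (simp add: pot_def[abs_def])
  have "(\<Sum>u\<in>verts G. g u * lap G (pot G A x) u) = (\<Sum>u\<in>{x}. g u * lap G (pot G A x) u)"
    using fin x g hits_harmonic[OF wf, of _ x A]
    by (intro sum.mono_neutral_right) (force simp: lap)+
  also have "\<dots> = g x * cond G A x"
    using lap_hits_root[OF wf x] by (simp add: lap cond_def)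
  finally show ?thesis by (simp add: dform_lap[OF wf])
qed

lemma energy_pot:
  assumes "wf_mgraph G" "mg_connected G" "A \<subseteq> verts G" "x \<in> verts G" "x \<notin> A"
  shows "dform G (pot G A x) (pot G A x) = 2 * cond G A x"
  using dform_pot[of G A x "pot G A x"] pot_other[of _ A x G] pot_root[of G A x] assms by force

text \<open>The difference between \<open>f\<close> and the voltage vanishes on
  \<open>insert x A\<close>, so it is orthogonal to the voltage in the energy form and can only add
  energy.\<close>

lemma dirichlet_principle:
  assumes "wf_mgraph G" "mg_connected G" "A \<subseteq> verts G" "x \<in> verts G" "x \<notin> A"
    and f: "f x = 1" "\<And>a. a \<in> A \<Longrightarrow> f a = 0"
  shows "2 * cond G A x \<le> dform G f f"
proof -
  define p where "p = pot G A x"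
  define g where "g v = f v - p v" for v
  have "g a = 0" if "a \<in> A" for a
    using that f assms(5) pot_other[of a A x G] by (auto simp: g_def p_def)
  moreover have "g x = 0" using pot_root[of G A x] assms by (simp add: g_def p_def)
  ultimately have "dform G p g = 0"
    using dform_pot[of G A x g] assms by (simp add: p_def)
  moreover have "f = (\<lambda>v. p v + g v)" by (simp add: g_def)
  ultimately have "dform G f f = dform G p p + dform G g g"
    using dform_square_add[of G p g] by simp
  then show ?thesis using energy_pot[of G A x] dform_nonneg[of G g] assms by (simp add: p_def)
qed

section \<open>Conductance under embeddings and next to an adjacent root\<close>

lemma embedding_darts:
  assumes "mg_embedding G H f g" and "wf_mgraph H"
  defines "h \<equiv> \<lambda>(e, u, v). (g e, f u, f v)"
  shows "inj_on h (darts H)" and "h ` darts H \<subseteq> darts G"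
    and "dform H (\<lambda>v. \<phi> (f v)) (\<lambda>v. \<phi> (f v)) = (\<Sum>(e, u, v)\<in>h ` darts H. (\<phi> u - \<phi> v)\<^sup>2)"
proof -
  have ends: "u \<in> verts H \<and> v \<in> verts H" if "(e, u, v) \<in> darts H" for e u v
    using that assms(2) by (auto simp: darts_def wf_mgraph_def)
  show inj: "inj_on h (darts H)"
    using assms(1) ends unfolding inj_on_def h_def mg_embedding_def
    by (auto simp: darts_def)
  show "h ` darts H \<subseteq> darts G"
    using assms(1) by (auto simp: h_def darts_def mg_embedding_def)
  show "dform H (\<lambda>v. \<phi> (f v)) (\<lambda>v. \<phi> (f v)) = (\<Sum>(e, u, v)\<in>h ` darts H. (\<phi> u - \<phi> v)\<^sup>2)"
    unfolding dform_def sum.reindex[OF inj] by (simp add: h_def case_prod_beta power2_eq_square)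
qed

text \<open>Rayleigh monotonicity: the voltage of \<open>G\<close>, pulled back along
  \<open>f\<close>, competes in the Dirichlet principle for \<open>H\<close>, and its energy is part
  of that in \<open>G\<close>. A missing edge from \<open>f y\<close> to \<open>A\<close> has
  voltage drop 1, so its energy makes the difference strict.\<close>

lemma cond_embedding:
  assumes emb: "mg_embedding G H f g"
    and G: "wf_mgraph G" "mg_connected G" and H: "wf_mgraph H" "mg_connected H"
    and A: "A \<subseteq> verts G" and y: "y \<in> verts H" "f y \<notin> A"
  defines "B \<equiv> {z\<in>verts H. f z \<in> A}"
  shows "cond H B y \<le> cond G A (f y)"
    and "e \<in> edges G \<Longrightarrow> e \<notin> g ` edges H \<Longrightarrow> ends G e = {f y, a} \<Longrightarrow> a \<in> A \<Longrightarrow>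
      cond H B y < cond G A (f y)"
proof -
  define \<phi> where "\<phi> = pot G A (f y)"
  define D where "D = (\<lambda>(e, u, v). (g e, f u, f v)) ` darts H"
  have fy: "f y \<in> verts G" using emb y by (auto simp: mg_embedding_def)
  note em = embedding_darts[OF emb H(1), folded D_def]
  have DG: "D \<subseteq> darts G" by (rule em(2))
  have \<phi>0: "\<phi> a = 0" if "a \<in> A" for a
    unfolding \<phi>_def using that y(2) by (intro pot_other) auto
  have 1: "2 * cond H B y \<le> (\<Sum>(e, u, v)\<in>D. (\<phi> u - \<phi> v)\<^sup>2)"
    unfolding em(3)[symmetric]
    using y pot_root[OF G A fy] \<phi>0
    by (intro dirichlet_principle H) (auto simp: B_def \<phi>_def)
  have 2: "2 * cond G A (f y) = (\<Sum>(e, u, v)\<in>darts G. (\<phi> u - \<phi> v)\<^sup>2)"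
    using energy_pot[OF G A fy y(2)] by (simp add: \<phi>_def dform_def power2_eq_square)
  have "(\<Sum>(e, u, v)\<in>D. (\<phi> u - \<phi> v)\<^sup>2) \<le> (\<Sum>(e, u, v)\<in>darts G. (\<phi> u - \<phi> v)\<^sup>2)"
    using DG finite_darts[OF G(1)] by (intro sum_mono2) auto
  then show "cond H B y \<le> cond G A (f y)" using 1 2 by linarith
  assume e: "e \<in> edges G" "e \<notin> g ` edges H" "ends G e = {f y, a}" "a \<in> A"
  have "a \<noteq> f y" using e y by auto
  then have "\<phi> a = 0" "\<phi> (f y) = 1"
    using e pot_root[OF G A fy] pot_other[of a A "f y" G] by (auto simp: \<phi>_def)
  then have "(\<Sum>(e, u, v)\<in>D. (\<phi> u - \<phi> v)\<^sup>2) < (\<Sum>(e, u, v)\<in>darts G. (\<phi> u - \<phi> v)\<^sup>2)"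
    using DG finite_darts[OF G(1)] e
    by (intro sum_strict_mono2[of _ _ "(e, f y, a)"]) (auto simp: darts_def D_def)
  then show "cond H B y < cond G A (f y)" using 1 2 by linarith
qed

text \<open>The edge \<open>e\<close> has voltage drop 1 and by itself accounts for one unit of
  conductance.\<close>

lemma cond_adjacent:
  assumes G: "wf_mgraph G" "mg_connected G" and A: "A \<subseteq> verts G" and x: "x \<in> verts G" "x \<notin> A"
    and e: "e \<in> edges G" "ends G e = {x, a}" "a \<in> A"
  shows "1 \<le> cond G A x" and "\<not> cut_edge G e \<Longrightarrow> 1 < cond G A x"
proof -
  define \<phi> where "\<phi> = pot G A x"
  define D where "D = {(e, x, a), (e, a, x)}"
  have ax: "a \<noteq> x" using e x by auto
  have \<phi>: "\<phi> a = 0" "\<phi> x = 1"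
    using ax e pot_root[OF G A x(1)] pot_other[of a A x G] by (auto simp: \<phi>_def)
  have DG: "D \<subseteq> darts G" using e by (auto simp: D_def darts_def)
  have 1: "(\<Sum>(e, u, v)\<in>D. (\<phi> u - \<phi> v)\<^sup>2) = 2" using ax \<phi> by (simp add: D_def)
  have 2: "2 * cond G A x = (\<Sum>(e, u, v)\<in>darts G. (\<phi> u - \<phi> v)\<^sup>2)"
    using energy_pot[OF G A x] by (simp add: \<phi>_def dform_def power2_eq_square)
  have "(\<Sum>(e, u, v)\<in>D. (\<phi> u - \<phi> v)\<^sup>2) \<le> (\<Sum>(e, u, v)\<in>darts G. (\<phi> u - \<phi> v)\<^sup>2)"
    using DG finite_darts[OF G(1)] by (intro sum_mono2) auto
  then show "1 \<le> cond G A x" using 1 2 by linarith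
  assume "\<not> cut_edge G e"
  then have r: "reach G (edges G - {e}) x a"
    using e x A by (auto simp: cut_edge_def connected_on_def)
  \<comment> \<open>Otherwise the voltage would be constant along a path from \<open>x\<close> to
    \<open>a\<close> that avoids \<open>e\<close>, although it is 1 at \<open>x\<close> and 0 at
    \<open>a\<close>.\<close>
  have "\<exists>d u v. (d, u, v) \<in> darts G \<and> d \<noteq> e \<and> \<phi> u \<noteq> \<phi> v"
  proof (rule ccontr)
    assume no: "\<not> ?thesis"
    from r have "\<phi> a = \<phi> x"
    proof (induction rule: reach.induct)
      case (step x y d z)
      then have "(d, y, z) \<in> darts G" "d \<noteq> e" by (auto simp: darts_def)
      with no step show ?case by metis
    qed simp
    with \<phi> show False by simp
  qed
  then obtain d u v where d: "(d, u, v) \<in> darts G" "d \<noteq> e" "\<phi> u \<noteq> \<phi> v" by blast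
  then have "(\<Sum>(e, u, v)\<in>D. (\<phi> u - \<phi> v)\<^sup>2) < (\<Sum>(e, u, v)\<in>darts G. (\<phi> u - \<phi> v)\<^sup>2)"
    using DG finite_darts[OF G(1)] by (intro sum_strict_mono2[of _ _ "(d, u, v)"]) (auto simp: D_def)
  then show "1 < cond G A x" using 1 2 by linarith
qed

section \<open>Spanning trees as rooted forests with one root\<close>

lemma reach_trans: "reach G F y z \<Longrightarrow> reach G F x y \<Longrightarrow> reach G F x z"
  by (induction rule: reach.induct) (auto intro: reach.step)

lemma reach_mono: "reach G F x y \<Longrightarrow> F \<subseteq> F' \<Longrightarrow> reach G F' x y"
  by (induction rule: reach.induct) (auto intro: reach.intros)

lemma reach_edge:
  assumes "wf_mgraph G" "e \<in> F" "e \<in> edges G" "ends G e = {x, y}"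
  shows "reach G F x y"
proof -
  have "x \<in> verts G" using assms by (auto simp: wf_mgraph_def)
  then show ?thesis using reach.step[OF reach.refl assms(2-4)] by simp
qed

lemma reach_sym:
  assumes "wf_mgraph G" "reach G F x y"
  shows "reach G F y x"
  using assms(2)
proof (induction rule: reach.induct)
  case (refl x)
  then show ?case by (rule reach.refl)
next
  case (step x y e z)
  have "reach G F z y"
    by (rule reach_edge[OF assms(1) step(2,3)]) (use step(4) in auto)
  with step.IH show ?case by (rule reach_trans)
qed

lemma reach_restrict_edges: "reach G F x y \<Longrightarrow> F \<subseteq> edges G \<Longrightarrow> reach (G\<lparr>edges := F\<rparr>) F x y"
proof (induction rule: reach.induct)
  case (refl x)
  then show ?case by (auto intro: reach.refl)
next
  case (step x y e z)
  then show ?case by (intro reach.step[of _ F x y e z]) auto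
qed

lemma flows_restrict_edges: "flows (G\<lparr>edges := F\<rparr>) A p n v b \<Longrightarrow> flows G A p n v b"
proof (induction rule: flows.induct)
  case (root b)
  then show ?case by (rule flows.root)
next
  case (up v w n b)
  then show ?case using flows.up[where p = p and v = v and w = w and G = G] by simp
qed

text \<open>Positivity of the forest count is applied to the subgraph with edge set
  \<open>F\<close>.\<close>

lemma connected_on_rforest:
  assumes wf: "wf_mgraph G" and F: "connected_on G F" "F \<subseteq> edges G" and x: "x \<in> verts G"
  obtains p where "p \<in> rforests G {x}" "p ` (verts G - {x}) \<subseteq> F"
proof -
  let ?G = "G\<lparr>edges := F\<rparr>"
  have "wf_mgraph ?G" using wf F(2) by (auto simp: wf_mgraph_def intro: finite_subset)
  moreover have "mg_connected ?G"
    using F reach_restrict_edges by (fastforce simp: mg_connected_def connected_on_def)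
  ultimately have "0 < card (rforests ?G {x})" using x by (intro rforests_pos) auto
  then obtain p where p: "p \<in> rforests ?G {x}" by (auto simp: card_gt_0_iff)
  have "\<exists>n b. flows G {x} p n v b" if v: "v \<in> verts G" for v
  proof -
    obtain n b where "flows ?G {x} p n v b" using rforestsD[OF p, of v] v by auto
    then have "flows G {x} p n v b" by (rule flows_restrict_edges)
    then show ?thesis by iprover
  qed
  moreover have "p \<in> (verts G - {x}) \<rightarrow>\<^sub>E F" using p by (simp add: rforests_def)
  ultimately show thesis
    using F(2) by (intro that[of p]) (auto simp: rforests_def PiE_iff)
qed

lemma rforests_step:
  assumes p: "p \<in> rforests G A" and z: "z \<in> verts G - A"
  obtains w n b where "p z \<in> edges G" "ends G (p z) = {z, w}"
    "flows G A p (Suc n) z b" "flows G A p n w b"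
proof -
  obtain m b where m: "flows G A p m z b" using rforestsD[OF p, of z] z by auto
  from m z obtain w n where "m = Suc n" "ends G (p z) = {z, w}" "flows G A p n w b"
    by cases simp_all
  moreover have "p z \<in> edges G" using p z by (auto simp: rforests_def)
  ultimately show thesis using m that by simp
qed

text \<open>Two vertices sharing a parent edge would be each other's parents, each one step further
  from the root than the other.\<close>

lemma rforests_inj:
  assumes p: "p \<in> rforests G A"
  shows "inj_on p (verts G - A)"
proof (rule inj_onI, rule ccontr)
  fix y z assume y: "y \<in> verts G - A" and z: "z \<in> verts G - A" and eq: "p y = p z" and ne: "y \<noteq> z"
  obtain v m b where v: "ends G (p y) = {y, v}" "flows G A p (Suc m) y b" "flows G A p m v b"
    using rforests_step[OF p y] by metis
  obtain w n c where w: "ends G (p z) = {z, w}" "flows G A p (Suc n) z c" "flows G A p n w c"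
    using rforests_step[OF p z] by metis
  have "v = z" "w = y" using v(1) w(1) eq ne by (auto simp: doubleton_eq_iff)
  then have "m = Suc n" "n = Suc m" using flows_det v w by metis+
  then show False by simp
qed

lemma flows_reach:
  assumes wf: "wf_mgraph G" and p: "p \<in> rforests G A"
  shows "flows G A p n v b \<Longrightarrow> v \<in> verts G \<Longrightarrow> reach G (p ` (verts G - A)) v b"
proof (induction rule: flows.induct)
  case (root b)
  then show ?case by (intro reach.refl)
next
  case (up v w n b)
  have e: "p v \<in> edges G" "p v \<in> p ` (verts G - A)" using p up(1,5) by (auto simp: rforests_def)
  have "w \<in> verts G" using wf e(1) up(2) by (auto simp: wf_mgraph_def)
  then have "reach G (p ` (verts G - A)) w b" by (rule up.IH)
  moreover have "reach G (p ` (verts G - A)) v w" by (rule reach_edge[OF wf e(2,1) up(2)])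
  ultimately show ?case by (rule reach_trans)
qed

text \<open>\<open>F\<close> contains the parent edges of a forest rooted at \<open>x\<close>, and
  these are pairwise distinct.\<close>

lemma connected_on_card:
  assumes "wf_mgraph G" "connected_on G F" "F \<subseteq> edges G" "x \<in> verts G"
  shows "card (verts G - {x}) \<le> card F"
proof -
  obtain p where p: "p \<in> rforests G {x}" "p ` (verts G - {x}) \<subseteq> F"
    using connected_on_rforest[OF assms] .
  have "finite F" using assms by (auto simp: wf_mgraph_def intro: finite_subset)
  with p(2) have "card (p ` (verts G - {x})) \<le> card F" by (intro card_mono)
  then show ?thesis using card_image[OF rforests_inj[OF p(1)]] by simp
qed

lemma rforest_spanning_tree:
  assumes wf: "wf_mgraph G" and x: "x \<in> verts G" and p: "p \<in> rforests G {x}"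
  shows "spanning_tree G (p ` (verts G - {x}))" (is "spanning_tree G ?T")
proof -
  have sub: "?T \<subseteq> edges G" using p by (auto simp: rforests_def)
  have to_x: "reach G ?T v x" if v: "v \<in> verts G" for v
  proof -
    obtain n b where nb: "flows G {x} p n v b" using rforestsD[OF p v] by iprover
    then show ?thesis using flows_reach[OF wf p nb v] flows_root[OF nb] by simp
  qed
  have "reach G ?T u v" if "u \<in> verts G" "v \<in> verts G" for u v
    using that by (intro reach_trans[OF reach_sym[OF wf to_x] to_x])
  then have con: "connected_on G ?T"
    using x unfolding connected_on_def by blast
  \<comment> \<open>Minimality by counting: without \<open>e\<close> there are fewer edges than
    \<open>connected_on_card\<close> demands.\<close>
  have "\<not> connected_on G (?T - {e})" if e: "e \<in> ?T" for e
  proof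
    assume "connected_on G (?T - {e})"
    then have "card (verts G - {x}) \<le> card (?T - {e})"
      using sub by (intro connected_on_card[OF wf _ _ x]) auto
    also have "\<dots> < card ?T"
      using e wf by (intro card_Diff1_less) (auto simp: wf_mgraph_def)
    also have "\<dots> = card (verts G - {x})" by (rule card_image[OF rforests_inj[OF p]])
    finally show False by simp
  qed
  with sub con show ?thesis by (simp add: spanning_tree_def)
qed

text \<open>Parent edges are compared by induction along the paths of \<open>p\<close>, starting at
  the roots.\<close>

lemma rforests_eqI:
  assumes p: "p \<in> rforests G A" and q: "q \<in> rforests G A"
    and eq: "p ` (verts G - A) = q ` (verts G - A)"
  shows "p = q"
proof -
  have *: "v \<in> verts G \<Longrightarrow> v \<notin> A \<Longrightarrow> p v = q v" if "flows G A p n v b" for n v b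
    using that
  proof (induction rule: flows.induct)
    case (root b)
    then show ?case by simp
  next
    case (up v w n b)
    show ?case
    proof (rule ccontr)
      assume ne: "p v \<noteq> q v"
      \<comment> \<open>If \<open>p v\<close> is not the parent edge of \<open>v\<close> in
        \<open>q\<close>, it is that of its other end \<open>w\<close>. By induction
        \<open>w\<close> has the same parent edge in \<open>p\<close>, so \<open>p\<close> would not
        be injective.\<close>
      have "p v \<in> q ` (verts G - A)" using up.prems eq by blast
      then obtain u where u: "u \<in> verts G - A" "p v = q u" by blast
      with ne have uv: "u \<noteq> v" by blast
      obtain w' where "ends G (q u) = {u, w'}" using rforests_step[OF q u(1)] by metis
      with up(2) u uv have "u = w" by (auto simp: doubleton_eq_iff)
      then have "p w = p v" using up.IH u by simp
      then show False
        using rforests_inj[OF p] uv \<open>u = w\<close> u(1) up.prems by (auto simp: inj_on_def)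
    qed
  qed
  have "p v = q v" if v: "v \<in> verts G - A" for v
  proof -
    obtain n b where "flows G A p n v b" using rforestsD[OF p, of v] v by auto
    then show ?thesis using * v by simp
  qed
  then show ?thesis
    using p q by (intro PiE_ext[of p "verts G - A" "\<lambda>_. edges G" q]) (auto simp: rforests_def)
qed

text \<open>The bijection takes a forest to its set of parent edges. It is onto because a spanning
  tree contains the parent edges of some forest; these already connect the graph, so by minimality
  no other edge is left.\<close>

lemma tau_eq_card_rforests:
  assumes wf: "wf_mgraph G" and x: "x \<in> verts G"
  shows "tau G = card (rforests G {x})"
proof -
  let ?im = "\<lambda>p. p ` (verts G - {x})"
  have "inj_on ?im (rforests G {x})"
    by (intro inj_onI) (elim rforests_eqI)
  moreover have "?im ` rforests G {x} = {T. spanning_tree G T}"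
  proof (intro subset_antisym subsetI)
    fix T assume "T \<in> ?im ` rforests G {x}"
    then obtain p where "p \<in> rforests G {x}" "T = ?im p" by (elim imageE)
    then show "T \<in> {T. spanning_tree G T}" using rforest_spanning_tree[OF wf x, of p] by simp
  next
    fix T assume "T \<in> {T. spanning_tree G T}"
    then have T: "T \<subseteq> edges G" "connected_on G T" "\<forall>e\<in>T. \<not> connected_on G (T - {e})"
      by (simp_all add: spanning_tree_def)
    obtain p where p: "p \<in> rforests G {x}" "?im p \<subseteq> T"
      using connected_on_rforest[OF wf T(2,1) x] .
    have con: "connected_on G (T - {e})" if "?im p \<subseteq> T - {e}" for e
      using rforest_spanning_tree[OF wf x p(1)] reach_mono[OF _ that, of G]
      unfolding spanning_tree_def connected_on_def by meson
    have "e \<in> ?im p" if e: "e \<in> T" for e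
    proof (rule ccontr)
      assume "e \<notin> ?im p"
      with p(2) have "?im p \<subseteq> T - {e}" by (simp only: subset_Diff_insert Diff_empty simp_thms)
      then show False using bspec[OF T(3) e] by (elim notE con)
    qed
    with p(2) have "?im p = T" by (rule subset_antisym[OF _ subsetI])
    with p(1) show "T \<in> ?im ` rforests G {x}" by (intro image_eqI[of _ _ p]) simp_all
  qed
  ultimately have "bij_betw ?im (rforests G {x}) {T. spanning_tree G T}"
    by (simp only: bij_betw_def)
  then show ?thesis unfolding tau_def by (rule bij_betw_same_card[symmetric])
qed

section \<open>Orderings of the vertices\<close>

definition before :: "('v, 'e) mgraph \<Rightarrow> ('v \<Rightarrow> nat) \<Rightarrow> 'v \<Rightarrow> 'v set" where
  "before G r x = {z \<in> verts G. r z < r x}"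

text \<open>The first vertex gets 0 because the telescoping starts from the forests rooted at it
  alone, which \<open>tau\<close> counts.\<close>

definition gain :: "('v, 'e) mgraph \<Rightarrow> ('v \<Rightarrow> nat) \<Rightarrow> 'v \<Rightarrow> real" where
  "gain G r x = (if before G r x = {} then 0 else ln (cond G (before G r x) x))"

definition search_order :: "('v, 'e) mgraph \<Rightarrow> ('v \<Rightarrow> nat) \<Rightarrow> 'v \<Rightarrow> bool" where
  "search_order G r v \<longleftrightarrow> inj_on r (verts G) \<and> v \<in> verts G \<and> r v = 0 \<and>
     (\<forall>x\<in>verts G - {v}. \<exists>e\<in>edges G. \<exists>a\<in>before G r x. ends G e = {x, a})"

lemma before_subset: "before G r x \<subseteq> verts G" "x \<notin> before G r x"
  by (auto simp: before_def)

lemma cond_pos: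
  assumes "wf_mgraph G" "mg_connected G" "A \<subseteq> verts G" "A \<noteq> {}" "x \<in> verts G"
  shows "0 < cond G A x"
  using rforests_pos[OF assms(1,2), of A] rforests_pos[OF assms(1,2), of "insert x A"] assms
  by (simp add: cond_def)

lemma tau_pos:
  assumes "wf_mgraph G" "mg_connected G"
  shows "0 < tau G"
proof -
  obtain x where x: "x \<in> verts G" using assms(2) by (auto simp: mg_connected_def connected_on_def)
  then show ?thesis using rforests_pos[OF assms, of "{x}"] tau_eq_card_rforests[OF assms(1) x] by simp
qed

text \<open>As roots are added in order of rank, each gain is the logarithm of a ratio of
  consecutive forest counts. These start at \<open>tau G\<close> for one root and end at 1 when all
  vertices are roots.\<close>

lemma sum_gain:
  assumes wf: "wf_mgraph G" and con: "mg_connected G" and inj: "inj_on r (verts G)"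
  shows "(\<Sum>x\<in>verts G. gain G r x) = ln (real (tau G))"
proof -
  have fin: "finite (verts G)" using wf by (simp add: wf_mgraph_def)
  have ne: "verts G \<noteq> {}" using con by (simp add: mg_connected_def connected_on_def)
  \<comment> \<open>Ranks may have gaps; at a gap this set stays the same.\<close>
  define A where "A m = {z \<in> verts G. r z < m}" for m
  have A: "A m \<subseteq> verts G" "finite (A m)" for m using fin by (auto simp: A_def)
  have *: "(\<Sum>x\<in>A m. gain G r x) = ln (real (tau G)) - ln (real (card (rforests G (A m))))"
    if "A m \<noteq> {}" for m
    using that
  proof (induction m)
    case 0
    then show ?case by (simp add: A_def)
  next
    case (Suc m)
    show ?case
    proof (cases "\<exists>x\<in>verts G. r x = m")
      case False
      then have "A (Suc m) = A m" by (auto simp: A_def less_Suc_eq)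
      with Suc show ?thesis by simp
    next
      case True
      then obtain x where x: "x \<in> verts G" "r x = m" by blast
      have AS: "A (Suc m) = insert x (A m)"
        using inj x by (auto simp: A_def less_Suc_eq inj_on_def)
      have b: "before G r x = A m" using x by (simp add: before_def A_def)
      have xA: "x \<notin> A m" using x by (simp add: A_def)
      show ?thesis
      proof (cases "A m = {}")
        case True
        then show ?thesis using AS b tau_eq_card_rforests[OF wf x(1)] by (simp add: gain_def)
      next
        case False
        have "0 < card (rforests G (A m))" "0 < card (rforests G (insert x (A m)))"
          using False A(1)[of m] x(1) by (intro rforests_pos wf con; simp)+
        then have "gain G r x = ln (real (card (rforests G (A m)))) -
            ln (real (card (rforests G (insert x (A m)))))"
          using False by (simp add: gain_def b cond_def ln_div)
        then show ?thesis using Suc.IH[OF False] A(2)[of m] xA by (simp add: AS)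
      qed
    qed
  qed
  have "A (Suc (Max (r ` verts G))) = verts G"
    using fin by (auto simp: A_def less_Suc_eq_le)
  then show ?thesis using *[of "Suc (Max (r ` verts G))"] ne by (simp add: rforests_verts)
qed

text \<open>A set is grown from \<open>v\<close> by boundary edges, each new vertex receiving a rank
  above all earlier ones.\<close>

lemma search_order_exists:
  assumes wf: "wf_mgraph G" and con: "mg_connected G" and v: "v \<in> verts G"
  obtains r where "search_order G r v"
proof -
  have fin: "finite (verts G)" using wf by (simp add: wf_mgraph_def)
  define P where "P A r \<longleftrightarrow> A \<subseteq> verts G \<and> v \<in> A \<and> inj_on r A \<and> r v = 0 \<and>
      (\<forall>x\<in>A - {v}. \<exists>e\<in>edges G. \<exists>a\<in>A. r a < r x \<and> ends G e = {x, a})" for A and r :: "'a \<Rightarrow> nat"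
  have "\<exists>A r. P A r \<and> card A = Suc k" if "k < card (verts G)" for k
    using that
  proof (induction k)
    case 0
    have "P {v} (\<lambda>_. 0)" using v by (simp add: P_def)
    then show ?case by (intro exI[of _ "{v}"]) auto
  next
    case (Suc k)
    then obtain A r where A: "P A r" "card A = Suc k" by auto
    have sub: "A \<subseteq> verts G" "v \<in> A" "finite A"
      using A fin by (auto simp: P_def intro: finite_subset)
    then obtain x where "x \<in> verts G" "x \<notin> A" using Suc.prems A(2) by (metis less_irrefl subsetI subset_antisym)
    with boundary_edge[OF wf con[unfolded mg_connected_def], of v A x] sub v
    obtain e u a where e: "e \<in> edges G" "u \<in> verts G" "u \<notin> A" "a \<in> A" "ends G e = {u, a}" by blast
    define r' where "r' = r(u := Suc (Max (r ` A)))"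
    have old: "r' z = r z" if "z \<in> A" for z using that e by (auto simp: r'_def)
    have new: "r' z < r' u" if "z \<in> A" for z
      using that sub(3) old[OF that] by (simp add: r'_def less_Suc_eq_le)
    have "inj_on r' (insert u A)"
    proof (subst inj_on_insert, intro conjI)
      show "inj_on r' A" using A old by (simp add: P_def inj_on_def)
      show "r' u \<notin> r' ` (A - {u})" using new by force
    qed
    moreover have "\<exists>e\<in>edges G. \<exists>b\<in>insert u A. r' b < r' x \<and> ends G e = {x, b}"
      if x: "x \<in> insert u A - {v}" for x
    proof (cases "x = u")
      case True
      then show ?thesis using e new by blast
    next
      case False
      then have "x \<in> A - {v}" using x by blast
      then obtain d b where "d \<in> edges G" "b \<in> A" "r b < r x" "ends G d = {x, b}"
        using A(1) unfolding P_def by blast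
      then show ?thesis using old[of b] old[of x] \<open>x \<in> A - {v}\<close> by force
    qed
    ultimately have "P (insert u A) r'"
      using A(1) e(2) old[OF sub(2)] by (auto simp: P_def)
    moreover have "card (insert u A) = Suc (Suc k)" using A e sub by simp
    ultimately show ?case by blast
  qed
  moreover have "card (verts G) \<noteq> 0" using v fin by auto
  then have "card (verts G) - 1 < card (verts G)" "Suc (card (verts G) - 1) = card (verts G)" by auto
  ultimately obtain A r where A: "P A r" "card A = card (verts G)" by metis
  then have "A = verts G" using fin by (intro card_subset_eq) (auto simp: P_def)
  with A(1) have "search_order G r v" unfolding P_def search_order_def before_def by blast
  then show thesis by (rule that)
qed

lemma gain_nonneg:
  assumes G: "wf_mgraph G" "mg_connected G" and r: "search_order G r v" and x: "x \<in> verts G"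
  shows "0 \<le> gain G r x"
    and "x \<noteq> v \<Longrightarrow> (\<And>e. \<not> cut_edge G e) \<Longrightarrow> 0 < gain G r x"
proof -
  have v: "before G r v = {}" using r by (simp add: search_order_def before_def)
  have *: "1 \<le> cond G (before G r x) x \<and> ((\<forall>e. \<not> cut_edge G e) \<longrightarrow> 1 < cond G (before G r x) x)
      \<and> before G r x \<noteq> {}" if "x \<noteq> v"
  proof -
    obtain e a where e: "e \<in> edges G" "a \<in> before G r x" "ends G e = {x, a}"
      using r x \<open>x \<noteq> v\<close> unfolding search_order_def by blast
    show ?thesis using cond_adjacent[OF G before_subset(1) x before_subset(2) e(1,3,2)] e(2) by blast
  qed
  show "0 \<le> gain G r x" using * v by (cases "x = v") (auto simp: gain_def)
  show "0 < gain G r x" if "x \<noteq> v" "\<And>e. \<not> cut_edge G e" using * that by (auto simp: gain_def)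
qed

lemma gain_embedding:
  assumes emb: "mg_embedding G H f g"
    and G: "wf_mgraph G" "mg_connected G" and H: "wf_mgraph H" "mg_connected H"
    and r: "search_order G r v" and y: "y \<in> verts H"
  shows "gain H (r \<circ> f) y \<le> gain G r (f y)"
    and "e \<in> edges G \<Longrightarrow> e \<notin> g ` edges H \<Longrightarrow> ends G e = {f y, f z} \<Longrightarrow> z \<in> verts H \<Longrightarrow>
      r (f z) < r (f y) \<Longrightarrow> gain H (r \<circ> f) y < gain G r (f y)"
proof -
  have fV: "f z \<in> verts G" if "z \<in> verts H" for z using emb that by (auto simp: mg_embedding_def)
  \<comment> \<open>The predecessors in \<open>H\<close> are those whose images precede
    \<open>f y\<close>, which is the set \<open>B\<close> of \<open>cond_embedding\<close>.\<close>
  have B: "before H (r \<circ> f) y = {z\<in>verts H. f z \<in> before G r (f y)}"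
    using fV by (auto simp: before_def)
  note ce = cond_embedding[OF emb G H before_subset(1) y before_subset(2)[of "f y" G r], folded B]
  have pos: "0 < cond H (before H (r \<circ> f) y) y" if "before H (r \<circ> f) y \<noteq> {}"
    using that y by (intro cond_pos H) (auto simp: before_def)
  have ne: "before G r (f y) \<noteq> {}" if "before H (r \<circ> f) y \<noteq> {}" using that B by auto
  show "gain H (r \<circ> f) y \<le> gain G r (f y)"
  proof (cases "before H (r \<circ> f) y = {}")
    \<comment> \<open>A first vertex of the copy has gain 0 in \<open>H\<close>, so nonnegativity of
      the gains in \<open>G\<close> suffices here.\<close>
    case True
    then show ?thesis using gain_nonneg(1)[OF G r fV[OF y]] by (simp add: gain_def)
  next
    case False
    then show ?thesis using pos ne ce(1) by (simp add: gain_def)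
  qed
  assume e: "e \<in> edges G" "e \<notin> g ` edges H" "ends G e = {f y, f z}" "z \<in> verts H" "r (f z) < r (f y)"
  have ne': "before H (r \<circ> f) y \<noteq> {}" "f z \<in> before G r (f y)"
    using e fV by (auto simp: before_def)
  then show "gain H (r \<circ> f) y < gain G r (f y)"
    using pos ne ce(2)[OF e(1-3)] by (simp add: gain_def)
qed

text \<open>\<open>r \<circ> f\<close> need not be a search order of \<open>H\<close>, but
  \<open>sum_gain\<close> asks only for an injective ranking, so the gains can be compared vertex by
  vertex.\<close>

lemma sum_gain_embedding:
  assumes emb: "mg_embedding G H f g"
    and G: "wf_mgraph G" "mg_connected G" and H: "wf_mgraph H" "mg_connected H"
    and r: "search_order G r v"
  shows "ln (real (tau H)) \<le> (\<Sum>y\<in>verts H. gain G r (f y))"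
    and "y \<in> verts H \<Longrightarrow> gain H (r \<circ> f) y < gain G r (f y) \<Longrightarrow>
      ln (real (tau H)) < (\<Sum>y\<in>verts H. gain G r (f y))"
proof -
  have inj: "inj_on (r \<circ> f) (verts H)"
    using emb r unfolding mg_embedding_def search_order_def
    by (intro comp_inj_on) (auto intro: inj_on_subset)
  have fin: "finite (verts H)" using H by (simp add: wf_mgraph_def)
  show "ln (real (tau H)) \<le> (\<Sum>y\<in>verts H. gain G r (f y))"
    unfolding sum_gain[OF H inj, symmetric]
    by (intro sum_mono gain_embedding(1)[OF emb G H r])
  show "ln (real (tau H)) < (\<Sum>y\<in>verts H. gain G r (f y))"
    if "y \<in> verts H" "gain H (r \<circ> f) y < gain G r (f y)"
    unfolding sum_gain[OF H inj, symmetric]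
    using fin that gain_embedding(1)[OF emb G H r] by (intro sum_strict_mono_ex1) auto
qed

section \<open>Averaging over automorphisms\<close>

text \<open>Only extensional vertex maps are taken, so that there are finitely many.\<close>

definition auts :: "('v, 'e) mgraph \<Rightarrow> ('v \<Rightarrow> 'v) set" where
  "auts G = {f \<in> verts G \<rightarrow>\<^sub>E verts G. \<exists>g. mg_iso G G f g}"

lemma finite_auts: "wf_mgraph G \<Longrightarrow> finite (auts G)"
  by (rule finite_subset[of _ "verts G \<rightarrow>\<^sub>E verts G"])
    (auto simp: auts_def wf_mgraph_def intro!: finite_PiE)

lemma mg_iso_comp:
  assumes "mg_iso G G f g" "mg_iso G G f' g'" "wf_mgraph G"
  shows "mg_iso G G (restrict (f' \<circ> f) (verts G)) (g' \<circ> g)"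
proof -
  have "bij_betw (f' \<circ> f) (verts G) (verts G)" "bij_betw (g' \<circ> g) (edges G) (edges G)"
    using assms by (auto simp: mg_iso_def intro: bij_betw_trans)
  moreover have "ends G (g' (g e)) = restrict (f' \<circ> f) (verts G) ` ends G e" if e: "e \<in> edges G" for e
  proof -
    have "g e \<in> edges G" using assms(1) e by (auto simp: mg_iso_def bij_betw_def)
    then have "ends G (g' (g e)) = f' ` f ` ends G e" using assms e by (simp add: mg_iso_def)
    also have "\<dots> = restrict (f' \<circ> f) (verts G) ` ends G e"
      using assms(3) e unfolding image_image by (intro image_cong) (auto simp: wf_mgraph_def)
    finally show ?thesis .
  qed
  ultimately show ?thesis by (simp add: mg_iso_def cong: bij_betw_cong)
qed

lemma mg_embedding_comp:
  assumes "mg_embedding G H f g" "mg_iso G G \<phi> h"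
  shows "mg_embedding G H (\<phi> \<circ> f) (h \<circ> g)"
proof -
  have "inj_on (\<phi> \<circ> f) (verts H)" "inj_on (h \<circ> g) (edges H)"
    using assms unfolding mg_embedding_def mg_iso_def bij_betw_def
    by (auto intro!: comp_inj_on intro: inj_on_subset)
  moreover have "(\<phi> \<circ> f) ` verts H \<subseteq> \<phi> ` verts G" "(h \<circ> g) ` edges H \<subseteq> h ` edges G"
    using assms(1) unfolding mg_embedding_def by auto
  moreover have "ends G (h (g e)) = \<phi> ` f ` ends H e" if e: "e \<in> edges H" for e
  proof -
    have "g e \<in> edges G" using assms(1) e by (auto simp: mg_embedding_def)
    then show ?thesis using assms e by (simp add: mg_embedding_def mg_iso_def)
  qed
  ultimately show ?thesis
    using assms(2) by (simp add: mg_embedding_def mg_iso_def bij_betw_def image_comp)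
qed

text \<open>Composition with an automorphism taking \<open>x\<close> to \<open>x'\<close> maps one
  fibre injectively into the other; restricting keeps the composites extensional.\<close>

lemma card_auts_fibre:
  assumes wf: "wf_mgraph G" and tr: "vertex_transitive G" and V: "y \<in> verts G" "x \<in> verts G" "x' \<in> verts G"
  shows "card {\<phi>\<in>auts G. \<phi> y = x} \<le> card {\<phi>\<in>auts G. \<phi> y = x'}"
proof -
  obtain f g where f: "mg_iso G G f g" "f x = x'" using tr V unfolding vertex_transitive_def by blast
  have bij: "bij_betw f (verts G) (verts G)" using f by (simp add: mg_iso_def)
  show ?thesis
  proof (rule card_inj_on_le[of "\<lambda>\<phi>. restrict (f \<circ> \<phi>) (verts G)"])
    show "finite {\<phi>\<in>auts G. \<phi> y = x'}" using finite_auts[OF wf] by simp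
    show "inj_on (\<lambda>\<phi>. restrict (f \<circ> \<phi>) (verts G)) {\<phi>\<in>auts G. \<phi> y = x}"
    proof (rule inj_onI)
      fix \<phi> \<psi>
      assume \<phi>: "\<phi> \<in> {\<phi>\<in>auts G. \<phi> y = x}" and \<psi>: "\<psi> \<in> {\<phi>\<in>auts G. \<phi> y = x}"
        and eq: "restrict (f \<circ> \<phi>) (verts G) = restrict (f \<circ> \<psi>) (verts G)"
      have PiE: "\<phi> \<in> verts G \<rightarrow>\<^sub>E verts G" "\<psi> \<in> verts G \<rightarrow>\<^sub>E verts G" using \<phi> \<psi> by (auto simp: auts_def)
      show "\<phi> = \<psi>"
      proof (rule PiE_ext[OF PiE])
        fix v assume v: "v \<in> verts G"
        then have "f (\<phi> v) = f (\<psi> v)" using fun_cong[OF eq, of v] by simp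
        then show "\<phi> v = \<psi> v"
          using bij PiE v by (auto simp: bij_betw_def inj_on_def PiE_iff)
      qed
    qed
    show "(\<lambda>\<phi>. restrict (f \<circ> \<phi>) (verts G)) ` {\<phi>\<in>auts G. \<phi> y = x} \<subseteq> {\<phi>\<in>auts G. \<phi> y = x'}"
    proof (rule image_subsetI)
      fix \<phi> assume \<phi>: "\<phi> \<in> {\<phi>\<in>auts G. \<phi> y = x}"
      then obtain h where h: "mg_iso G G \<phi> h" by (auto simp: auts_def)
      have iso: "mg_iso G G (restrict (f \<circ> \<phi>) (verts G)) (g \<circ> h)" by (rule mg_iso_comp[OF h f(1) wf])
      then have "restrict (f \<circ> \<phi>) (verts G) \<in> verts G \<rightarrow>\<^sub>E verts G"
        unfolding mg_iso_def bij_betw_def PiE_iff by auto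
      with iso show "restrict (f \<circ> \<phi>) (verts G) \<in> {\<phi>\<in>auts G. \<phi> y = x'}"
        using \<phi> f(2) V(1) by (auto simp: auts_def)
    qed
  qed
qed

text \<open>By transitivity equally many automorphisms move \<open>y\<close> to each vertex, so
  averaging over automorphisms is averaging over vertices.\<close>

lemma sum_auts:
  fixes c :: "'v \<Rightarrow> real" and G :: "('v, 'e) mgraph"
  assumes wf: "wf_mgraph G" and tr: "vertex_transitive G" and y: "y \<in> verts G"
  shows "real (card (verts G)) * (\<Sum>\<phi>\<in>auts G. c (\<phi> y)) = real (card (auts G)) * (\<Sum>x\<in>verts G. c x)"
proof -
  have fin: "finite (verts G)" using wf by (simp add: wf_mgraph_def)
  define N where "N = card {\<phi>\<in>auts G. \<phi> y = y}"
  have N: "card {\<phi>\<in>auts G. \<phi> y = x} = N" if "x \<in> verts G" for x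
    unfolding N_def using card_auts_fibre[OF wf tr] that y by (intro antisym)
  have im: "(\<lambda>\<phi>. \<phi> y) ` auts G \<subseteq> verts G" using y by (auto simp: auts_def)
  have "(\<Sum>\<phi>\<in>auts G. d (\<phi> y)) = real N * (\<Sum>x\<in>verts G. d x)" for d :: "'v \<Rightarrow> real"
  proof -
    have "(\<Sum>\<phi>\<in>auts G. d (\<phi> y)) = (\<Sum>x\<in>verts G. \<Sum>\<phi>\<in>{\<phi>\<in>auts G. \<phi> y = x}. d (\<phi> y))"
      by (rule sum.group[OF finite_auts[OF wf] fin im, symmetric])
    also have "\<dots> = (\<Sum>x\<in>verts G. real N * d x)" using N by (intro sum.cong) auto
    finally show ?thesis by (simp add: sum_distrib_left)
  qed
  \<comment> \<open>The constant function 1 gives \<open>card (auts G) = N * card (verts G)\<close>,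
    which eliminates \<open>N\<close>.\<close>
  from this[of c] this[of "\<lambda>_. 1"] show ?thesis by simp
qed

lemma id_auts: "wf_mgraph G \<Longrightarrow> restrict id (verts G) \<in> auts G"
  by (auto simp: auts_def mg_iso_def wf_mgraph_def bij_betw_def inj_on_def subset_iff
      intro!: exI[of _ id])

text \<open>The total gain \<open>S\<close> over all images of the copy is viewed in two ways: each
  automorphism contributes at least \<open>ln (tau H)\<close>, while each vertex of \<open>H\<close>
  contributes on average \<open>ln (tau G) / n\<close> per automorphism.\<close>

lemma tree_entropy_embedding:
  assumes emb: "mg_embedding G H f g"
    and G: "wf_mgraph G" "mg_connected G" and H: "wf_mgraph H" "mg_connected H"
    and tr: "vertex_transitive G" and r: "search_order G r v"
  shows "ln (real (tau H)) / real (card (verts H)) \<le> ln (real (tau G)) / real (card (verts G))"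
    and "y \<in> verts H \<Longrightarrow> gain H (r \<circ> f) y < gain G r (f y) \<Longrightarrow>
      ln (real (tau H)) / real (card (verts H)) < ln (real (tau G)) / real (card (verts G))"
proof -
  define \<Gamma> where "\<Gamma> = real (card (auts G))"
  define k where "k = real (card (verts H))"
  define n where "n = real (card (verts G))"
  define S where "S = (\<Sum>\<phi>\<in>auts G. \<Sum>y\<in>verts H. gain G r (\<phi> (f y)))"
  have pos: "\<Gamma> > 0" "k > 0" "n > 0"
    using finite_auts[OF G(1)] id_auts[OF G(1)] G H
    by (auto simp: \<Gamma>_def k_def n_def card_gt_0_iff wf_mgraph_def mg_connected_def connected_on_def)
  have fV: "f y \<in> verts G" if "y \<in> verts H" for y using emb that by (auto simp: mg_embedding_def)
  have inj: "inj_on r (verts G)" using r by (simp add: search_order_def)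
  have "n * S = (\<Sum>y\<in>verts H. n * (\<Sum>\<phi>\<in>auts G. gain G r (\<phi> (f y))))"
    unfolding S_def by (subst sum.swap) (simp add: sum_distrib_left)
  also have "\<dots> = (\<Sum>y\<in>verts H. \<Gamma> * ln (real (tau G)))"
    using sum_auts[OF G(1) tr fV, of _ "gain G r"] sum_gain[OF G inj]
    by (intro sum.cong) (simp_all add: n_def \<Gamma>_def)
  finally have S: "n * S = k * (\<Gamma> * ln (real (tau G)))" by (simp add: k_def)
  have le: "ln (real (tau H)) \<le> (\<Sum>y\<in>verts H. gain G r (\<phi> (f y)))" if \<phi>: "\<phi> \<in> auts G" for \<phi>
  proof -
    obtain h where "mg_iso G G \<phi> h" using \<phi> by (auto simp: auts_def)
    from sum_gain_embedding(1)[OF mg_embedding_comp[OF emb this] G H r] show ?thesis by simp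
  qed
  have "\<Gamma> * ln (real (tau H)) \<le> S"
    unfolding S_def \<Gamma>_def using sum_mono[of "auts G" "\<lambda>_. ln (real (tau H))"] le by simp
  then have "n * (\<Gamma> * ln (real (tau H))) \<le> k * (\<Gamma> * ln (real (tau G)))"
    using pos by (simp flip: S)
  then show "ln (real (tau H)) / real (card (verts H)) \<le> ln (real (tau G)) / real (card (verts G))"
    using pos by (simp add: field_simps flip: k_def n_def)
  assume y: "y \<in> verts H" "gain H (r \<circ> f) y < gain G r (f y)"
  \<comment> \<open>The given copy is its own image under the identity, and one strict term makes
    the whole sum strict.\<close>
  have "ln (real (tau H)) < (\<Sum>y\<in>verts H. gain G r (f y))"
    by (rule sum_gain_embedding(2)[OF emb G H r y])
  also have "\<dots> = (\<Sum>y\<in>verts H. gain G r (restrict id (verts G) (f y)))"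
    using fV by (intro sum.cong) auto
  finally have "(\<Sum>\<phi>\<in>auts G. ln (real (tau H))) < S"
    unfolding S_def using le finite_auts[OF G(1)] id_auts[OF G(1)]
    by (intro sum_strict_mono_ex1 bexI[of _ "restrict id (verts G)"]) simp_all
  then have "n * (\<Gamma> * ln (real (tau H))) < k * (\<Gamma> * ln (real (tau G)))"
    using pos(3) unfolding S[symmetric] by (simp add: \<Gamma>_def)
  then show "ln (real (tau H)) / real (card (verts H)) < ln (real (tau G)) / real (card (verts G))"
    using pos by (simp add: field_simps flip: k_def n_def)
qed

lemma tree_entropy_embedding_strict:
  assumes emb: "mg_embedding G H f g"
    and G: "wf_mgraph G" "mg_connected G" and H: "wf_mgraph H" "mg_connected H"
    and tr: "vertex_transitive G"
    and cut: "\<And>e. \<not> cut_edge G e" and ne: "\<not> mg_isomorphic G H"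
  shows "ln (real (tau H)) / real (card (verts H)) < ln (real (tau G)) / real (card (verts G))"
proof (cases "f ` verts H = verts G")
  case False
  with emb obtain v where v: "v \<in> verts G" "v \<notin> f ` verts H" by (auto simp: mg_embedding_def)
  obtain r where r: "search_order G r v" using search_order_exists[OF G v(1)] .
  have "finite (verts H)" "verts H \<noteq> {}"
    using H by (auto simp: wf_mgraph_def mg_connected_def connected_on_def)
  \<comment> \<open>A first vertex of the copy: its gain is 0 in \<open>H\<close>, but positive in
    \<open>G\<close> because \<open>f y\<close> is not the starting vertex \<open>v\<close>.\<close>
  then obtain y where y: "y \<in> verts H" "\<not> (\<exists>z\<in>verts H. (r \<circ> f) z < (r \<circ> f) y)"
    using arg_min_if_finite[of "verts H" "r \<circ> f"] by blast
  then have "before H (r \<circ> f) y = {}" by (simp add: before_def)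
  moreover have "f y \<in> verts G" "f y \<noteq> v" using emb y v by (auto simp: mg_embedding_def)
  then have "0 < gain G r (f y)" using gain_nonneg(2)[OF G r] cut by blast
  ultimately have "gain H (r \<circ> f) y < gain G r (f y)" by (simp add: gain_def)
  then show ?thesis by (rule tree_entropy_embedding(2)[OF emb G H tr r y(1)])
next
  case True
  \<comment> \<open>As the copy has all the vertices, it can differ from \<open>G\<close> only by a
    missing edge.\<close>
  have "g ` edges H \<noteq> edges G"
  proof
    assume "g ` edges H = edges G"
    with True emb have "mg_iso G H f g" by (auto simp: mg_iso_def mg_embedding_def bij_betw_def)
    with ne show False by (auto simp: mg_isomorphic_def)
  qed
  with emb obtain e where e: "e \<in> edges G" "e \<notin> g ` edges H" by (auto simp: mg_embedding_def)
  have "card (ends G e) = 2" "ends G e \<subseteq> verts G"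
    using G(1) e(1) by (simp_all add: wf_mgraph_def)
  then obtain u v where uv: "ends G e = {u, v}" "u \<noteq> v" "u \<in> verts G" "v \<in> verts G"
    by (auto simp: card_2_iff)
  obtain y z where y: "y \<in> verts H" "u = f y" and z: "z \<in> verts H" "v = f z"
    using True uv by blast
  \<comment> \<open>Starting at \<open>v\<close>, which is \<open>f z\<close>, puts \<open>z\<close>
    before \<open>y\<close>, so the missing edge joins \<open>f y\<close> to a predecessor.\<close>
  obtain r where r: "search_order G r v" using search_order_exists[OF G uv(4)] .
  have "r v = 0" "inj_on r (verts G)" using r by (simp_all add: search_order_def)
  then have "r v < r u" using inj_onD[of r "verts G" u v] uv by (cases "r u = 0") simp_all
  then have "gain H (r \<circ> f) y < gain G r (f y)"
    using uv y z by (intro gain_embedding(2)[OF emb G H r y(1) e, of z]) auto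
  then show ?thesis by (rule tree_entropy_embedding(2)[OF emb G H tr r y(1)])
qed

theorem theorem3p3:
  fixes G :: "('v, 'e) mgraph" and H :: "('w, 'f) mgraph"
  assumes "wf_mgraph G" and "wf_mgraph H"
    and "mg_connected G" and "mg_connected H"
    and "vertex_transitive G"
    and "dominates G H"
  shows "real (tau G) powr (1 / real (card (verts G)))
           \<ge> real (tau H) powr (1 / real (card (verts H))) \<and>
         ((\<forall>e. \<not> cut_edge G e) \<and> \<not> mg_isomorphic G H \<longrightarrow>
           real (tau G) powr (1 / real (card (verts G)))
             > real (tau H) powr (1 / real (card (verts H))))"
proof -
  obtain p :: "('v \<times> 'w) pmf" where p: "\<forall>(x, y)\<in>set_pmf p. \<exists>f g. mg_embedding G H f g \<and> f y = x"
    using assms(6) unfolding dominates_def by blast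
  \<comment> \<open>The support of a probability measure is nonempty, and any pair in it provides an
    embedding.\<close>
  obtain x y where "(x, y) \<in> set_pmf p" using set_pmf_not_empty[of p] by fastforce
  with p obtain f g where emb: "mg_embedding G H f g" by fastforce
  obtain v where "v \<in> verts G" using assms(3) by (auto simp: mg_connected_def connected_on_def)
  then obtain r where r: "search_order G r v" using search_order_exists[OF assms(1,3)] by blast
  have pos: "0 < tau G" "0 < tau H" using tau_pos assms by auto
  note le = tree_entropy_embedding(1)[OF emb assms(1,3,2,4,5) r]
    and less = tree_entropy_embedding_strict[OF emb assms(1,3,2,4,5)]
  \<comment> \<open>For positive \<open>t\<close>, \<open>t powr (1 / n)\<close> is
    \<open>exp (ln t / n)\<close>, so the comparison of logarithms is exponentiated.\<close>
  show ?thesis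
    using pos le less by (simp add: powr_def)
qed

end
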